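(* Let $r\in\{4,5\}$ and let $\Gamma$ be the Levi graph of $\mathrm{PG}(2,r)$. Then, by deleting from $\Gamma$ the six vertices corresponding to three non-collinear points $P_1,P_2,P_3$ and the three lines $P_1P_2$, $P_2P_3$, $P_3P_1$, and then deleting a suitable (possibly empty) set of pairwise independent edges joining vertices of degree $r+1$ of the remaining graph, one can obtain: \begin{itemize} \item for $r=4$, a $(4,5;6)$-babi-cage of order $36$; \item for $r=5$, a $(5,6;6)$-babi-cage of order $56$. \end{itemize}
   Context: Graphs are finite and simple. The girth of a graph is the length of its shortest cycle; the order of a graph is its number of vertices. For integers $1\leq r\leq s$ and $g\geq 3$, an $(r,s;g)$-balanced biregular graph (for short, $(r,s;g)$-babi-graph) is a graph of girth $g$ whose set of vertex degrees equals $\{r,s\}$ and in which the number of vertices of degree $r$ equals the number of vertices of degree $s$. An $(r,s;g)$-babi-cage is an $(r,s;g)$-babi-graph of minimum order among all $(r,s;g)$-babi-graphs. $\mathrm{PG}(2,q)$ is the projective plane of order $q$ coordinatized by the finite field of order $q$ (points and lines are the $1$- and $2$-dimensional subspaces of the $3$-dimensional vector space over that field, with incidence given by containment). $P_iP_j$ denotes the line through the distinct points $P_i$ and $P_j$. The Levi graph (incidence graph) of a point-line incidence structure is the bipartite graph whose two classes are the set of points and the set of lines, a point and a line being adjacent if and only if they are incident. *)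

theory Defs
  imports
    "HOL-Analysis.Cartesian_Space"
    "HOL-Library.Numeral_Type"
    "HOL-Library.Extended_Nat"
begin

section \<open>Finite simple graphs\<close>

type_synonym 'a sgraph = "'a set \<times> 'a set set"

abbreviation verts :: "'a sgraph \<Rightarrow> 'a set" where "verts G \<equiv> fst G"
abbreviation edges :: "'a sgraph \<Rightarrow> 'a set set" where "edges G \<equiv> snd G"

definition simple_graph :: "'a sgraph \<Rightarrow> bool" where
  "simple_graph G \<longleftrightarrow> finite (verts G) \<and> (\<forall>e\<in>edges G. e \<subseteq> verts G \<and> card e = 2)"

definition graph_order :: "'a sgraph \<Rightarrow> nat" where
  "graph_order G = card (verts G)"

definition vdegree :: "'a sgraph \<Rightarrow> 'a \<Rightarrow> nat" where
  "vdegree G v = card {e \<in> edges G. v \<in> e}"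

text \<open>A cycle is given by its vertices in cyclic order, so its length is the length of the list.\<close>

definition is_cycle :: "'a sgraph \<Rightarrow> 'a list \<Rightarrow> bool" where
  "is_cycle G c \<longleftrightarrow> 3 \<le> length c \<and> distinct c \<and>
     (\<forall>i<length c. {c ! i, c ! (Suc i mod length c)} \<in> edges G)"

text \<open>The girth of an acyclic graph is \<open>\<infinity>\<close>.\<close>

definition girth :: "'a sgraph \<Rightarrow> enat" where
  "girth G = (INF c\<in>{c. is_cycle G c}. enat (length c))"

definition delete_verts :: "'a sgraph \<Rightarrow> 'a set \<Rightarrow> 'a sgraph" where
  "delete_verts G S = (verts G - S, {e \<in> edges G. e \<inter> S = {}})"

definition delete_edges :: "'a sgraph \<Rightarrow> 'a set set \<Rightarrow> 'a sgraph" where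
  "delete_edges G M = (verts G, edges G - M)"

definition independent_edges :: "'a set set \<Rightarrow> bool" where
  "independent_edges M \<longleftrightarrow> pairwise disjnt M"


section \<open>Balanced biregular graphs and cages\<close>

definition babi_graph :: "nat \<Rightarrow> nat \<Rightarrow> nat \<Rightarrow> 'a sgraph \<Rightarrow> bool" where
  "babi_graph r s g G \<longleftrightarrow> simple_graph G \<and> girth G = enat g \<and>
     vdegree G ` verts G = {r, s} \<and>
     card {v \<in> verts G. vdegree G v = r} = card {v \<in> verts G. vdegree G v = s}"

text \<open>
  A definition cannot quantify over types, so the competing graphs \<open>H\<close> are taken with natural
  numbers as vertices. As every finite graph is isomorphic to such a graph, this is no restriction:
  see lemma \<open>babi_cage_minimal\<close> below.
\<close>

definition babi_cage :: "nat \<Rightarrow> nat \<Rightarrow> nat \<Rightarrow> 'a sgraph \<Rightarrow> bool" where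
  "babi_cage r s g G \<longleftrightarrow> babi_graph r s g G \<and>
     (\<forall>H :: nat sgraph. babi_graph r s g H \<longrightarrow> graph_order G \<le> graph_order H)"

lemma is_cycle_verts:
  assumes "is_cycle G c" and "simple_graph G"
  shows "set c \<subseteq> verts G"
  using assms by (fastforce simp: is_cycle_def simple_graph_def in_set_conv_nth)

lemma babi_graph_image:
  fixes f :: "'a \<Rightarrow> 'b"
  assumes f: "inj_on f (verts G)" and G: "babi_graph r s g G"
  shows "babi_graph r s g (f ` verts G, (`) f ` edges G)" (is "babi_graph r s g ?H")
proof -
  have sg: "simple_graph G" using G by (simp add: babi_graph_def)
  then have Pow: "e \<subseteq> verts G" if "e \<in> edges G" for e
    using that by (simp add: simple_graph_def)
  have inj: "inj_on ((`) f) (edges G)"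
    by (rule inj_onI) (metis Pow f inj_on_image_eq_iff)
  have sub: "f ` A \<in> (`) f ` edges G \<longleftrightarrow> A \<in> edges G" if "A \<subseteq> verts G" for A
    using that f Pow by (metis (no_types, lifting) image_iff inj_on_image_eq_iff)
  have deg: "vdegree ?H (f v) = vdegree G v" if v: "v \<in> verts G" for v
  proof -
    have "f v \<in> f ` e \<longleftrightarrow> v \<in> e" if "e \<in> edges G" for e
      using inj_on_image_mem_iff[OF f v Pow[OF that]] .
    then have "{e \<in> edges ?H. f v \<in> e} = (`) f ` {e \<in> edges G. v \<in> e}"
      by auto
    moreover have "inj_on ((`) f) {e \<in> edges G. v \<in> e}"
      by (rule inj_on_subset[OF inj]) auto
    ultimately show ?thesis by (simp add: vdegree_def card_image)
  qed
  have degs: "card {v \<in> verts ?H. vdegree ?H v = k} = card {v \<in> verts G. vdegree G v = k}" for k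
  proof -
    have "{v \<in> verts ?H. vdegree ?H v = k} = f ` {v \<in> verts G. vdegree G v = k}"
      using deg by auto
    moreover have "inj_on f {v \<in> verts G. vdegree G v = k}"
      by (rule inj_on_subset[OF f]) auto
    ultimately show ?thesis by (simp add: card_image)
  qed
  have sgH: "simple_graph ?H"
    using sg by (auto simp: simple_graph_def card_image inj_on_subset[OF f])
  have lt: "Suc i mod n < n" if "i < n" for i n :: nat
    using that by (auto intro: mod_less_divisor)
  have cyc: "is_cycle ?H (map f c) \<longleftrightarrow> is_cycle G c" if c: "set c \<subseteq> verts G" for c
  proof -
    have "{f (c ! i), f (c ! (Suc i mod length c))} \<in> (`) f ` edges G \<longleftrightarrow>
          {c ! i, c ! (Suc i mod length c)} \<in> edges G" if "i < length c" for i
      using sub[of "{c ! i, c ! (Suc i mod length c)}"] c lt[OF that] nth_mem that by auto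
    moreover have "map f c ! (Suc i mod length c) = f (c ! (Suc i mod length c))"
      if "i < length c" for i
      using lt[OF that] by simp
    ultimately show ?thesis
      using inj_on_subset[OF f c] by (simp add: is_cycle_def distinct_map)
  qed
  have "{c. is_cycle ?H c} = map f ` {c. is_cycle G c}"
  proof (intro set_eqI iffI)
    fix c assume c: "c \<in> {c. is_cycle ?H c}"
    then have "set c \<subseteq> f ` verts G" using is_cycle_verts[of ?H c] sgH by simp
    then have "c \<in> map f ` lists (verts G)" by (metis in_listsI lists_image subsetD)
    then obtain d where "c = map f d" "set d \<subseteq> verts G" by auto
    with c cyc show "c \<in> map f ` {c. is_cycle G c}" by auto
  next
    fix c assume "c \<in> map f ` {c. is_cycle G c}"
    then show "c \<in> {c. is_cycle ?H c}" using cyc is_cycle_verts[OF _ sg] by auto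
  qed
  then have "girth ?H = girth G" by (simp add: girth_def image_image)
  moreover have "vdegree ?H ` verts ?H = vdegree G ` verts G"
    using deg by (simp add: image_image)
  ultimately show ?thesis
    using G sgH degs by (simp add: babi_graph_def)
qed

lemma babi_graph_nat:
  fixes H :: "'b sgraph"
  assumes "babi_graph r s g H"
  shows "\<exists>K :: nat sgraph. babi_graph r s g K \<and> graph_order K = graph_order H"
proof -
  have "finite (verts H)" using assms by (simp add: babi_graph_def simple_graph_def)
  then obtain f :: "'b \<Rightarrow> nat" where f: "inj_on f (verts H)"
    using finite_imp_inj_to_nat_seg by metis
  then have "graph_order (f ` verts H, (`) f ` edges H) = graph_order H"
    by (simp add: graph_order_def card_image)
  then show ?thesis using babi_graph_image[OF f assms] by blast
qed

lemma babi_cage_minimal: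
  fixes G :: "'a sgraph" and H :: "'b sgraph"
  assumes "babi_cage r s g G" and "babi_graph r s g H"
  shows "graph_order G \<le> graph_order H"
  using assms babi_graph_nat by (metis babi_cage_def)


section \<open>The projective plane over a field and its Levi graph\<close>

text \<open>
  The field is the type \<open>'k\<close>; \<open>PG(2,q)\<close> is obtained when \<open>'k\<close> is finite with \<open>q\<close> elements.
\<close>

definition pg_points :: "('k::field ^ 3) set set" where
  "pg_points = {p. vec.subspace p \<and> vec.dim p = 1}"

definition pg_lines :: "('k::field ^ 3) set set" where
  "pg_lines = {l. vec.subspace l \<and> vec.dim l = 2}"

definition line_through :: "('k::field ^ 3) set \<Rightarrow> ('k ^ 3) set \<Rightarrow> ('k ^ 3) set" where
  "line_through p q = (THE l. l \<in> pg_lines \<and> p \<subseteq> l \<and> q \<subseteq> l)"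

definition collinear_points :: "('k::field ^ 3) set set \<Rightarrow> bool" where
  "collinear_points S \<longleftrightarrow> (\<exists>l\<in>pg_lines. \<forall>p\<in>S. p \<subseteq> l)"

definition levi_graph :: "'p set \<Rightarrow> 'l set \<Rightarrow> ('p \<Rightarrow> 'l \<Rightarrow> bool) \<Rightarrow> ('p + 'l) sgraph" where
  "levi_graph P L I =
     (Inl ` P \<union> Inr ` L, {{Inl p, Inr l} | p l. p \<in> P \<and> l \<in> L \<and> I p l})"

definition pg_levi_graph :: "(('k::field ^ 3) set + ('k ^ 3) set) sgraph" where
  "pg_levi_graph = levi_graph pg_points pg_lines (\<subseteq>)"

text \<open>The Levi graph without the vertices and the sides of the triangle \<open>P\<^sub>1P\<^sub>2P\<^sub>3\<close>.\<close>

definition triangle_deleted ::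
    "('k::field ^ 3) set \<Rightarrow> ('k ^ 3) set \<Rightarrow> ('k ^ 3) set \<Rightarrow> (('k ^ 3) set + ('k ^ 3) set) sgraph"
where
  "triangle_deleted P1 P2 P3 = delete_verts pg_levi_graph
     {Inl P1, Inl P2, Inl P3,
      Inr (line_through P1 P2), Inr (line_through P2 P3), Inr (line_through P3 P1)}"

end

theory Submission
  imports Defs
begin

text \<open>
  The vertices of lower degree in the Levi graph of a projective plane of order \<open>q\<close> without a
  triangle are the remaining points on the sides and the remaining lines through the corners: each of
  them has lost exactly one neighbour, a side or a corner. So there are \<open>6 * (q - 1)\<close> vertices of
  degree \<open>q\<close> and \<open>2 * (q - 1)\<^sup>2\<close> of degree \<open>q + 1\<close>. Deleting an edge between two vertices of
  degree \<open>q + 1\<close>, independently of the others, moves two vertices from the second class to the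
  first, so both classes become equal after \<open>(q - 1) * (q - 4) / 2\<close> deletions: none for \<open>q = 4\<close>
  and two for \<open>q = 5\<close> (lemma \<open>two_independent_edges\<close>). The Levi graph is bipartite, and it has no
  cycle of length four because two points are on one line only. A cycle of length six survives all
  deletions: choose one point on each side of the triangle, not all on one line. Their three joins are
  not sides, and as the three points have degree \<open>q\<close>, no deleted edge meets them
  (lemma \<open>girth_delete_edges\<close>).

  Minimality of the order is a refined Moore bound (lemma \<open>babi_graph_order_lower_bound\<close>). In a graph
  of girth six the ends of the walks of length two from \<open>u\<close> and from \<open>v\<close> form disjoint
  sets if \<open>u\<close> and \<open>v\<close> are adjacent, and their sizes are determined by the degrees of the
  neighbours. Applied to an edge between vertices of degree \<open>r + 1\<close>, this shows that the order of an
  \<open>(r, r + 1; 6)\<close>-graph is at least \<open>2 * r\<^sup>2 + 2\<close>, and the case of equality is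
  excluded by the balance of the two classes. As the number of edges is an integer, the order is
  moreover a multiple of four. A multiple of four that is at least \<open>35\<close> is at least
  \<open>36\<close>, and one that is at least \<open>53\<close> is at least \<open>56\<close>.
\<close>

section \<open>Neighbourhoods, degrees and short cycles\<close>

definition nbrs :: "'a sgraph \<Rightarrow> 'a \<Rightarrow> 'a set" where
  "nbrs G v = {w. {v, w} \<in> edges G}"

text \<open>
  A vertex with a neighbour is deliberately an element of its own second neighbourhood, so that
  the second neighbourhoods of the two ends of an edge account for both ends.
\<close>

definition second_nbrs :: "'a sgraph \<Rightarrow> 'a \<Rightarrow> 'a set" where
  "second_nbrs G v = (\<Union>w\<in>nbrs G v. nbrs G w)"

lemma nbrs_sym: "w \<in> nbrs G v \<longleftrightarrow> v \<in> nbrs G w"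
  by (simp add: nbrs_def insert_commute)

lemma nbrs_subset_verts:
  assumes "simple_graph G"
  shows "nbrs G v \<subseteq> verts G"
  using assms by (auto simp: nbrs_def simple_graph_def)

lemma finite_nbrs:
  assumes "simple_graph G"
  shows "finite (nbrs G v)"
  using assms nbrs_subset_verts by (metis finite_subset simple_graph_def)

lemma not_in_nbrs_self:
  assumes "simple_graph G"
  shows "v \<notin> nbrs G v"
  using assms by (auto simp: nbrs_def simple_graph_def)

lemma vdegree_eq_card_nbrs:
  assumes "simple_graph G"
  shows "vdegree G v = card (nbrs G v)"
proof -
  have "bij_betw (\<lambda>w. {v, w}) (nbrs G v) {e \<in> edges G. v \<in> e}"
  proof (rule bij_betw_imageI)
    show "inj_on (\<lambda>w. {v, w}) (nbrs G v)"
      by (auto simp: inj_on_def doubleton_eq_iff)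
    have "\<exists>w. e = {v, w}" if "e \<in> edges G" "v \<in> e" for e
      using assms that by (auto simp: simple_graph_def card_2_iff)
    then show "(\<lambda>w. {v, w}) ` nbrs G v = {e \<in> edges G. v \<in> e}"
      by (auto simp: nbrs_def)
  qed
  then show ?thesis by (simp add: vdegree_def bij_betw_same_card)
qed

lemma finite_edges:
  assumes "simple_graph G"
  shows "finite (edges G)"
proof (rule finite_subset)
  show "edges G \<subseteq> Pow (verts G)" using assms by (auto simp: simple_graph_def)
  show "finite (Pow (verts G))" using assms by (simp add: simple_graph_def)
qed

lemma sum_vdegree:
  assumes "simple_graph G"
  shows "(\<Sum>v\<in>verts G. vdegree G v) = 2 * card (edges G)"
  unfolding vdegree_def
proof (rule sum_multicount)
  show "finite (verts G)" using assms by (simp add: simple_graph_def)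
  show "finite (edges G)" using finite_edges[OF assms] .
  have "{v \<in> verts G. v \<in> e} = e" if "e \<in> edges G" for e
    using assms that by (auto simp: simple_graph_def)
  then show "\<forall>e\<in>edges G. card {v \<in> verts G. v \<in> e} = 2"
    using assms by (simp add: simple_graph_def)
qed

lemma girth_ge_iff: "enat g \<le> girth G \<longleftrightarrow> (\<forall>c. is_cycle G c \<longrightarrow> g \<le> length c)"
  by (simp add: girth_def le_INF_iff)

lemma is_cycle_3:
  "is_cycle G [a, b, c] \<longleftrightarrow>
     distinct [a, b, c] \<and> b \<in> nbrs G a \<and> c \<in> nbrs G b \<and> a \<in> nbrs G c"
  by (simp add: is_cycle_def nbrs_def All_less_Suc, auto simp: numeral_eq_Suc)

lemma is_cycle_4:
  "is_cycle G [a, b, c, d] \<longleftrightarrow>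
     distinct [a, b, c, d] \<and> b \<in> nbrs G a \<and> c \<in> nbrs G b \<and> d \<in> nbrs G c \<and> a \<in> nbrs G d"
  by (simp add: is_cycle_def nbrs_def All_less_Suc, auto simp: numeral_eq_Suc)

lemma is_cycle_5:
  "is_cycle G [a, b, c, d, e] \<longleftrightarrow>
     distinct [a, b, c, d, e] \<and> b \<in> nbrs G a \<and> c \<in> nbrs G b \<and> d \<in> nbrs G c \<and> e \<in> nbrs G d
       \<and> a \<in> nbrs G e"
  by (simp add: is_cycle_def nbrs_def All_less_Suc, auto simp: numeral_eq_Suc)

lemma is_cycle_6:
  "is_cycle G [a, b, c, d, e, f] \<longleftrightarrow>
     distinct [a, b, c, d, e, f] \<and> b \<in> nbrs G a \<and> c \<in> nbrs G b \<and> d \<in> nbrs G c \<and> e \<in> nbrs G d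
       \<and> f \<in> nbrs G e \<and> a \<in> nbrs G f"
  by (simp add: is_cycle_def nbrs_def All_less_Suc, auto simp: numeral_eq_Suc)

text \<open>
  The neighbourhoods of two neighbours of \<open>v\<close> have only \<open>v\<close> in common, because
  another common vertex would close a cycle of length four.
\<close>

lemma card_second_nbrs:
  assumes G: "simple_graph G" and girth: "5 \<le> girth G" and ne: "nbrs G v \<noteq> {}"
  shows "card (second_nbrs G v) = Suc (\<Sum>w\<in>nbrs G v. vdegree G w - 1)"
proof -
  have girth': "enat 5 \<le> girth G" using girth by (simp add: numeral_eq_enat)
  have v: "v \<in> nbrs G w" if "w \<in> nbrs G v" for w using that nbrs_sym by metis
  have "second_nbrs G v = insert v (\<Union>w\<in>nbrs G v. nbrs G w - {v})"
    using ne v by (auto simp: second_nbrs_def)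
  moreover have "card (insert v (\<Union>w\<in>nbrs G v. nbrs G w - {v}))
      = Suc (card (\<Union>w\<in>nbrs G v. nbrs G w - {v}))"
    by (rule card_insert_disjoint) (auto intro: finite_nbrs[OF G])
  moreover have "card (\<Union>w\<in>nbrs G v. nbrs G w - {v}) = (\<Sum>w\<in>nbrs G v. card (nbrs G w - {v}))"
  proof (rule card_UN_disjoint)
    show "\<forall>w\<in>nbrs G v. \<forall>w'\<in>nbrs G v. w \<noteq> w' \<longrightarrow> (nbrs G w - {v}) \<inter> (nbrs G w' - {v}) = {}"
    proof (intro ballI impI equals0I)
      fix w w' x
      assume A: "w \<in> nbrs G v" "w' \<in> nbrs G v" "w \<noteq> w'"
        and x: "x \<in> (nbrs G w - {v}) \<inter> (nbrs G w' - {v})"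
      have "is_cycle G [v, w, x, w']"
        using A x not_in_nbrs_self[OF G] unfolding is_cycle_4 by (auto simp: nbrs_sym)
      then show False using girth' unfolding girth_ge_iff by fastforce
    qed
  qed (auto intro: finite_nbrs[OF G])
  moreover have "card (nbrs G w - {v}) = vdegree G w - 1" if "w \<in> nbrs G v" for w
    using v[OF that] by (simp add: vdegree_eq_card_nbrs[OF G] finite_nbrs[OF G])
  ultimately show ?thesis by simp
qed

text \<open>
  A common element gives a closed walk of length five through the edge; as there are no loops and no
  triangles, this walk is a cycle.
\<close>

lemma second_nbrs_disjoint:
  assumes G: "simple_graph G" and girth: "6 \<le> girth G" and uv: "v \<in> nbrs G u"
  shows "second_nbrs G u \<inter> second_nbrs G v = {}"
proof (rule equals0I)
  fix z assume "z \<in> second_nbrs G u \<inter> second_nbrs G v"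
  then obtain x y where x: "x \<in> nbrs G u" "z \<in> nbrs G x" and y: "y \<in> nbrs G v" "z \<in> nbrs G y"
    by (auto simp: second_nbrs_def)
  have no: "\<not> is_cycle G c" if "length c < 6" for c
    using girth that girth_ge_iff[of 6 G] by (auto simp: numeral_eq_enat)
  have no3: False if "b \<in> nbrs G a" "c \<in> nbrs G b" "a \<in> nbrs G c" for a b c
    using no[of "[a, b, c]"] that not_in_nbrs_self[OF G] unfolding is_cycle_3 by auto
  have "x \<noteq> y" using no3[of x u v] x y uv nbrs_sym by metis
  moreover have "x \<noteq> v" using no3[of y v z] x y uv nbrs_sym by metis
  moreover have "y \<noteq> u" using no3[of x u z] x y uv nbrs_sym by metis
  moreover have "z \<noteq> u" using no3[of y u v] x y uv nbrs_sym by metis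
  moreover have "z \<noteq> v" using no3[of x u v] x y uv nbrs_sym by metis
  ultimately have "is_cycle G [u, x, z, y, v]"
    using x y uv not_in_nbrs_self[OF G] unfolding is_cycle_5 by (auto simp: nbrs_sym)
  then show False using no by fastforce
qed

section \<open>A lower bound for the order of balanced biregular graphs of girth six\<close>

text \<open>
  Let \<open>X\<close> and \<open>Y\<close> be the classes of vertices of degree \<open>r + 1\<close> and \<open>r\<close>, of
  size \<open>m\<close> each, and let \<open>a v\<close> be the number of neighbours of \<open>v\<close> in \<open>X\<close>. A vertex \<open>v\<close>
  of \<open>X\<close> has a second neighbourhood of size \<open>r\<^sup>2 + a v\<close>, so adjacent vertices \<open>u\<close>, \<open>v\<close> of
  \<open>X\<close> give \<open>2 * m \<ge> 2 * r\<^sup>2 + a u + a v\<close>. At most \<open>r * m\<close> of the \<open>(r + 1) * m\<close> edge ends in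
  \<open>X\<close> lead to \<open>Y\<close>, so \<open>a\<close> has mean value at least one on \<open>X\<close>. Either some value is at least
  two, and the estimate is strict; or \<open>a\<close> is constantly one on \<open>X\<close> and \<open>Y\<close> is an independent set,
  so that most of both second neighbourhoods lies in \<open>X\<close> alone, which is only half of the graph.
\<close>

lemma babi_graph_order_lower_bound:
  fixes H :: "'a sgraph"
  assumes H: "babi_graph r (Suc r) 6 H" and r: "2 \<le> r"
  shows "4 dvd graph_order H" and "2 * r\<^sup>2 + 3 \<le> graph_order H"
proof -
  define X where "X = {v \<in> verts H. vdegree H v = Suc r}"
  define Y where "Y = {v \<in> verts H. vdegree H v = r}"
  define m where "m = card X"
  have sg: "simple_graph H" and girth: "girth H = 6" and degs: "vdegree H ` verts H = {r, Suc r}"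
    and cY: "card Y = m"
    using H by (auto simp: babi_graph_def X_def Y_def m_def numeral_eq_enat)
  have fin: "finite (verts H)" using sg by (simp add: simple_graph_def)
  have XY: "verts H = X \<union> Y" "X \<inter> Y = {}" and fX: "finite X" and fY: "finite Y"
    using degs fin by (auto simp: X_def Y_def)
  have order: "graph_order H = 2 * m"
    using XY fX fY cY by (simp add: graph_order_def card_Un_disjoint m_def)
  have "X \<noteq> {}" using degs by (force simp: X_def)
  then have m: "0 < m" using fX by (simp add: m_def card_gt_0_iff)

  \<comment> \<open>The degree sum \<open>(2 * r + 1) * m\<close> is even, hence so is \<open>m\<close>.\<close>
  have "(\<Sum>v\<in>verts H. vdegree H v) = (\<Sum>v\<in>X. Suc r) + (\<Sum>v\<in>Y. r)"
    unfolding XY(1) using XY fX fY by (subst sum.union_disjoint) (auto simp: X_def Y_def)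
  then have "2 * card (edges H) = m * Suc r + m * r"
    using sum_vdegree[OF sg] cY by (simp add: m_def)
  also have "\<dots> = m + 2 * (m * r)" by simp
  finally have "even m" by presburger
  then show "4 dvd graph_order H" unfolding order by (auto elim!: evenE)

  define a where "a v = card (nbrs H v \<inter> X)" for v
  have N: "nbrs H v \<subseteq> X \<union> Y" for v using nbrs_subset_verts[OF sg] XY by metis
  have fN: "finite (nbrs H v)" for v using finite_nbrs[OF sg] .
  have split: "vdegree H v = a v + card (nbrs H v \<inter> Y)" for v
  proof -
    have "nbrs H v = (nbrs H v \<inter> X) \<union> (nbrs H v \<inter> Y)" using N[of v] by blast
    then have "card (nbrs H v) = card (nbrs H v \<inter> X) + card (nbrs H v \<inter> Y)"
      using XY(2) fX fY by (metis (no_types, lifting) card_Un_disjoint finite_Int inf_assoc inf_bot_right inf_left_commute)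
    then show ?thesis by (simp add: vdegree_eq_card_nbrs[OF sg] a_def)
  qed
  have ne: "nbrs H v \<noteq> {}" if "v \<in> X" for v
    using that vdegree_eq_card_nbrs[OF sg, of v] by (auto simp: X_def)
  have S: "card (second_nbrs H v) = r\<^sup>2 + a v" if v: "v \<in> X" for v
  proof -
    have "(\<Sum>w\<in>nbrs H v. vdegree H w - 1) = (\<Sum>w\<in>nbrs H v. (r - 1) + of_bool (w \<in> X))"
      using N[of v] XY(2) r by (intro sum.cong refl) (auto simp: X_def Y_def)
    also have "\<dots> = Suc r * (r - 1) + a v"
      using v fN[of v] vdegree_eq_card_nbrs[OF sg, of v]
      by (simp add: sum.distrib X_def a_def of_bool_def sum.If_cases Int_def)
    also have "Suc (Suc r * (r - 1)) = r\<^sup>2"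
      using r by (cases r) (auto simp: power2_eq_square)
    then have "Suc (Suc r * (r - 1) + a v) = r\<^sup>2 + a v" by simp
    finally show ?thesis using card_second_nbrs[OF sg _ ne[OF v]] girth by simp
  qed
  have subV: "second_nbrs H v \<subseteq> verts H" for v
    using nbrs_subset_verts[OF sg] by (auto simp: second_nbrs_def)
  have disj: "second_nbrs H u \<inter> second_nbrs H v = {}" if "v \<in> nbrs H u" for u v
    using second_nbrs_disjoint[OF sg _ that] girth by simp
  have big: "2 * r\<^sup>2 + a u + a v \<le> 2 * m" if "u \<in> X" "v \<in> X" "v \<in> nbrs H u" for u v
  proof -
    have "card (second_nbrs H u \<union> second_nbrs H v) \<le> card (verts H)"
      using subV fin by (simp add: card_mono)
    moreover have "card (second_nbrs H u \<union> second_nbrs H v)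
        = card (second_nbrs H u) + card (second_nbrs H v)"
      using disj[OF that(3)] subV fin by (meson card_Un_disjoint finite_subset)
    ultimately show ?thesis using S that order by (simp add: graph_order_def)
  qed
  have a_pos: "1 \<le> a v" if "u \<in> X" "v \<in> nbrs H u" for u v
    using that fX card_gt_0_iff[of "nbrs H v \<inter> X"] nbrs_sym[of u H v] by (fastforce simp: a_def)

  have XYcount: "(\<Sum>v\<in>X. card (nbrs H v \<inter> Y)) = (\<Sum>w\<in>Y. a w)"
  proof -
    have "(\<Sum>v\<in>X. card {w \<in> Y. w \<in> nbrs H v}) = (\<Sum>w\<in>Y. a w)"
      by (rule sum_multicount_gen[OF fX fY]) (auto simp: a_def nbrs_sym intro!: arg_cong[where f = card])
    then show ?thesis by (simp add: Int_def conj_commute)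
  qed
  have aY: "a w \<le> r" if "w \<in> Y" for w using split[of w] that by (simp add: Y_def)
  show "2 * r\<^sup>2 + 3 \<le> graph_order H"
  proof (cases "\<exists>u\<in>X. 2 \<le> a u")
    case True
    then obtain u where u: "u \<in> X" "2 \<le> a u" by blast
    then obtain v where v: "v \<in> X" "v \<in> nbrs H u"
      by (metis IntE a_def card.empty ex_in_conv not_numeral_le_zero)
    show ?thesis using big[OF u(1) v] u(2) a_pos[OF u(1) v(2)] order by simp
  next
    case False
    then have le1: "a u \<le> 1" if "u \<in> X" for u using that by fastforce
    have toY: "card (nbrs H u \<inter> Y) = Suc r - a u" if "u \<in> X" for u
    proof -
      have "vdegree H u = Suc r" using that by (simp add: X_def)
      then show ?thesis using split[of u] by linarith
    qed
    have "\<exists>u\<in>X. a u \<noteq> 0"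
    proof (rule ccontr)
      assume "\<not> ?thesis"
      then have "(\<Sum>v\<in>X. card (nbrs H v \<inter> Y)) = m * Suc r" by (simp add: toY m_def)
      moreover have "(\<Sum>w\<in>Y. a w) \<le> m * r" using sum_bounded_above[of Y a r] aY cY by simp
      ultimately show False using XYcount m by simp
    qed
    then obtain u v where u: "u \<in> X" and v: "v \<in> X" and uv: "v \<in> nbrs H u"
      by (metis IntE a_def card.empty ex_in_conv)
    have "m * r = (\<Sum>v\<in>X. r)" by (simp add: m_def)
    also have "\<dots> \<le> (\<Sum>v\<in>X. card (nbrs H v \<inter> Y))"
      by (rule sum_mono) (use toY le1 in fastforce)
    finally have "(\<Sum>w\<in>Y. r) \<le> (\<Sum>w\<in>Y. a w)" by (simp add: cY XYcount)
    \<comment> \<open>The edges between the classes are already as numerous as the degrees in \<open>Y\<close> permit.\<close>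
    then have aYr: "a w = r" if "w \<in> Y" for w
      using sum_mono_inv[of a Y "\<lambda>_. r"] sum_mono[of Y a "\<lambda>_. r"] aY that fY
      by (metis (no_types, lifting) le_antisym)
    then have YX: "nbrs H w \<subseteq> X" if "w \<in> Y" for w
    proof -
      have "vdegree H w = r" using that by (simp add: Y_def)
      then have "card (nbrs H w \<inter> Y) = 0" using split[of w] aYr[OF that] by linarith
      then show ?thesis using N[of w] fY by auto
    qed
    \<comment> \<open>All neighbours of \<open>u\<close> except \<open>v\<close> are in \<open>Y\<close>, and their neighbours are in \<open>X\<close>. So only
       the \<open>r\<close> neighbours of \<open>v\<close> other than \<open>u\<close> can be second neighbours of \<open>u\<close> outside \<open>X\<close>.\<close>
    have half: "r\<^sup>2 + 1 - r \<le> card (second_nbrs H u \<inter> X)"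
      if u: "u \<in> X" and v: "v \<in> X" and uv: "v \<in> nbrs H u" for u v
    proof -
      have uv': "u \<in> nbrs H v" using uv nbrs_sym by metis
      have a1: "a u = 1" using le1[OF u] a_pos[OF v uv'] by simp
      then obtain x where "nbrs H u \<inter> X = {x}" unfolding a_def by (rule card_1_singletonE)
      then have "nbrs H u \<inter> X = {v}" using v uv by (metis IntI singletonD)
      then have "nbrs H u \<subseteq> insert v Y" using N[of u] by blast
      then have "second_nbrs H u \<subseteq> X \<union> nbrs H v" using YX by (fastforce simp: second_nbrs_def)
      then have "second_nbrs H u \<subseteq> (second_nbrs H u \<inter> X) \<union> (nbrs H v - {u})" using u uv by auto
      then have "card (second_nbrs H u) \<le> card ((second_nbrs H u \<inter> X) \<union> (nbrs H v - {u}))"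
        using fX fN by (intro card_mono) auto
      also have "\<dots> \<le> card (second_nbrs H u \<inter> X) + card (nbrs H v - {u})" by (rule card_Un_le)
      also have "card (nbrs H v - {u}) = r"
        using uv' v fN vdegree_eq_card_nbrs[OF sg, of v] by (simp add: X_def)
      finally show ?thesis using S[OF u] a1 by simp
    qed
    have "card ((second_nbrs H u \<inter> X) \<union> (second_nbrs H v \<inter> X)) \<le> m"
      unfolding m_def using fX by (intro card_mono) auto
    moreover have "card ((second_nbrs H u \<inter> X) \<union> (second_nbrs H v \<inter> X))
        = card (second_nbrs H u \<inter> X) + card (second_nbrs H v \<inter> X)"
      using disj[OF uv] fX by (intro card_Un_disjoint) auto
    ultimately have "2 * (r\<^sup>2 + 1 - r) \<le> m"
      using half[OF u v uv] half[OF v u] uv nbrs_sym[of u H v] by simp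
    moreover have "2 * r\<^sup>2 + 3 \<le> 4 * (r\<^sup>2 + 1 - r)"
    proof -
      obtain k where "r = k + 2" using r by (metis add.commute le_Suc_ex)
      then show ?thesis by (simp add: power2_eq_square algebra_simps)
    qed
    ultimately show ?thesis unfolding order by linarith
  qed
qed

section \<open>Deletion of independent edges\<close>

lemma simple_graph_delete_edges: "simple_graph G \<Longrightarrow> simple_graph (delete_edges G M)"
  by (auto simp: simple_graph_def delete_edges_def)

lemma is_cycle_delete_edges:
  "is_cycle (delete_edges G M) c \<longleftrightarrow>
     is_cycle G c \<and> (\<forall>i<length c. {c ! i, c ! (Suc i mod length c)} \<notin> M)"
  by (auto simp: is_cycle_def delete_edges_def)

lemma card_Union_independent_edges:
  assumes "simple_graph G" "M \<subseteq> edges G" "independent_edges M"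
  shows "card (\<Union>M) = 2 * card M"
proof -
  have "card (\<Union>M) = (\<Sum>e\<in>M. card e)"
    using assms by (intro card_Union_disjoint)
      (auto simp: independent_edges_def simple_graph_def card_2_iff)
  also have "\<dots> = (\<Sum>e\<in>M. 2)"
    using assms by (intro sum.cong) (auto simp: simple_graph_def)
  finally show ?thesis by simp
qed

lemma vdegree_delete_independent_edges:
  assumes G: "simple_graph G" and M: "M \<subseteq> edges G" "independent_edges M"
  shows "vdegree (delete_edges G M) v = vdegree G v - of_bool (v \<in> \<Union>M)"
proof -
  have "card {e \<in> M. v \<in> e} = of_bool (v \<in> \<Union>M)"
  proof (cases "v \<in> \<Union>M")
    case True
    then obtain e where "e \<in> M" "v \<in> e" by blast
    then have "{e \<in> M. v \<in> e} = {e}"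
      using M(2) by (auto simp: independent_edges_def pairwise_def disjnt_iff)
    then show ?thesis using True by simp
  next
    case False
    then have "{e \<in> M. v \<in> e} = {}" by blast
    then have "card {e \<in> M. v \<in> e} = 0" by (simp only: card.empty)
    moreover have "of_bool (v \<in> \<Union>M) = (0 :: nat)" using False by (simp only: of_bool_eq)
    ultimately show ?thesis by (simp only:)
  qed
  moreover have "{e \<in> edges (delete_edges G M). v \<in> e} = {e \<in> edges G. v \<in> e} - {e \<in> M. v \<in> e}"
    by (auto simp: delete_edges_def)
  moreover have "card ({e \<in> edges G. v \<in> e} - {e \<in> M. v \<in> e})
      = card {e \<in> edges G. v \<in> e} - card {e \<in> M. v \<in> e}"
  proof (rule card_Diff_subset)
    show "finite {e \<in> M. v \<in> e}"
      using finite_subset[OF M(1) finite_edges[OF G]] by simp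
    show "{e \<in> M. v \<in> e} \<subseteq> {e \<in> edges G. v \<in> e}" using M(1) by blast
  qed
  ultimately show ?thesis by (simp only: vdegree_def)
qed

text \<open>
  With each of the deleted edges, two vertices of degree \<open>q + 1\<close> get degree \<open>q\<close>. The difference of
  the sizes of the two classes changes by four.
\<close>

lemma balanced_delete_independent_edges:
  assumes G: "simple_graph G" and M: "M \<subseteq> edges G" "independent_edges M"
    and Mdeg: "\<forall>e\<in>M. \<forall>v\<in>e. vdegree G v = Suc q"
    and degs: "\<forall>v\<in>verts G. vdegree G v = q \<or> vdegree G v = Suc q"
    and low: "0 < card {v \<in> verts G. vdegree G v = q}"
    and bal: "card {v \<in> verts G. vdegree G v = q} + 4 * card M
        = card {v \<in> verts G. vdegree G v = Suc q}"
  defines "H \<equiv> delete_edges G M"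
  shows "vdegree H ` verts H = {q, Suc q}"
    and "card {v \<in> verts H. vdegree H v = q} = card {v \<in> verts H. vdegree H v = Suc q}"
proof -
  let ?A = "{v \<in> verts G. vdegree G v = q}" and ?B = "{v \<in> verts G. vdegree G v = Suc q}"
  have fin: "finite (verts G)" using G by (simp add: simple_graph_def)
  have UM: "\<Union>M \<subseteq> ?B" using M(1) Mdeg G by (auto simp: simple_graph_def)
  have V: "verts H = verts G" by (simp add: H_def delete_edges_def)
  have deg: "vdegree H v = vdegree G v - of_bool (v \<in> \<Union>M)" for v
    using vdegree_delete_independent_edges[OF G M] by (simp add: H_def)
  have A: "{v \<in> verts H. vdegree H v = q} = ?A \<union> \<Union>M"
    using UM degs by (auto simp: V deg simp del: Union_iff)
  have B: "{v \<in> verts H. vdegree H v = Suc q} = ?B - \<Union>M"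
    using UM degs by (auto simp: V deg simp del: Union_iff)
  have cM: "card (\<Union>M) = 2 * card M" using card_Union_independent_edges[OF G M] .
  have fM: "finite (\<Union>M)" by (rule finite_subset[OF UM]) (use fin in simp)
  have "card (?A \<union> \<Union>M) = card ?A + 2 * card M"
    unfolding cM[symmetric] using UM fin fM by (intro card_Un_disjoint) auto
  moreover have cB: "card (?B - \<Union>M) = card ?B - 2 * card M"
    unfolding cM[symmetric] using UM fM by (intro card_Diff_subset) auto
  ultimately show "card {v \<in> verts H. vdegree H v = q} = card {v \<in> verts H. vdegree H v = Suc q}"
    unfolding A B using bal by linarith
  have "?A \<noteq> {}" using low by fastforce
  then obtain v where v: "v \<in> verts H" "vdegree H v = q" using A by blast
  have "?B - \<Union>M \<noteq> {}"
  proof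
    assume "?B - \<Union>M = {}"
    then have "card (?B - \<Union>M) = 0" by (simp only: card.empty)
    then show False using cB bal low by linarith
  qed
  then obtain w where w: "w \<in> verts H" "vdegree H w = Suc q" using B by blast
  have "vdegree H u = q \<or> vdegree H u = Suc q" if "u \<in> verts H" for u
    using that degs UM by (auto simp: V deg simp del: Union_iff)
  then have "vdegree H ` verts H \<subseteq> {q, Suc q}" by blast
  moreover have "{q, Suc q} \<subseteq> vdegree H ` verts H"
    using imageI[OF v(1), of "vdegree H"] imageI[OF w(1), of "vdegree H"] v(2) w(2) by simp
  ultimately show "vdegree H ` verts H = {q, Suc q}" by (rule subset_antisym)
qed

section \<open>Levi graphs\<close>

lemma simple_graph_levi:
  assumes "finite P" "finite L"
  shows "simple_graph (levi_graph P L I)"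
  using assms by (auto simp: simple_graph_def levi_graph_def)

lemma nbrs_levi:
  "nbrs (levi_graph P L I) (Inl x) = (if x \<in> P then Inr ` {l \<in> L. I x l} else {})"
  "nbrs (levi_graph P L I) (Inr l) = (if l \<in> L then Inl ` {x \<in> P. I x l} else {})"
  by (auto simp: nbrs_def levi_graph_def doubleton_eq_iff)

lemma vdegree_levi:
  assumes "finite P" "finite L"
  shows "x \<in> P \<Longrightarrow> vdegree (levi_graph P L I) (Inl x) = card {l \<in> L. I x l}"
    and "l \<in> L \<Longrightarrow> vdegree (levi_graph P L I) (Inr l) = card {x \<in> P. I x l}"
  by (simp_all add: vdegree_eq_card_nbrs[OF simple_graph_levi[OF assms]] nbrs_levi card_image)

lemma card_Inl_Inr:
  assumes "finite A" "finite B"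
  shows "card (Inl ` A \<union> Inr ` B) = card A + card B"
  using assms by (subst card_Un_disjoint) (auto simp: card_image)

lemma card_verts_levi:
  assumes "finite P" "finite L"
  shows "card {v \<in> verts (levi_graph P L I). Q v} = card {x \<in> P. Q (Inl x)} + card {l \<in> L. Q (Inr l)}"
proof -
  have "{v \<in> verts (levi_graph P L I). Q v} = Inl ` {x \<in> P. Q (Inl x)} \<union> Inr ` {l \<in> L. Q (Inr l)}"
    by (auto simp: levi_graph_def)
  then show ?thesis using assms by (simp add: card_Inl_Inr)
qed

lemma delete_verts_levi:
  "delete_verts (levi_graph P L I) (Inl ` A \<union> Inr ` B) = levi_graph (P - A) (L - B) I"
proof -
  have "Inl ` P \<union> Inr ` L - (Inl ` A \<union> Inr ` B) = Inl ` (P - A) \<union> Inr ` (L - B)" by auto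
  moreover have "{e \<in> edges (levi_graph P L I). e \<inter> (Inl ` A \<union> Inr ` B) = {}}
      = edges (levi_graph (P - A) (L - B) I)"
    by (auto simp: levi_graph_def image_iff doubleton_eq_iff)
  ultimately show ?thesis by (simp add: delete_verts_def levi_graph_def)
qed

text \<open>
  Cycles of odd length do not occur in a bipartite graph, and a cycle of length four consists of two
  points and two lines joining them.
\<close>

lemma levi_cycle_length:
  assumes join: "\<And>x y l m. \<lbrakk>x \<in> P; y \<in> P; x \<noteq> y; l \<in> L; m \<in> L; I x l; I y l; I x m; I y m\<rbrakk> \<Longrightarrow> l = m"
    and c: "is_cycle (levi_graph P L I) c"
  shows "6 \<le> length c"
proof (rule ccontr)
  assume "\<not> ?thesis"
  moreover have "3 \<le> length c" using c by (simp add: is_cycle_def)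
  ultimately consider "length c = 3" | "length c = 4" | "length c = 5" by linarith
  then show False
  proof cases
    case 1
    then obtain a b d where "c = [a, b, d]" by (auto simp: numeral_eq_Suc length_Suc_conv)
    with c have "is_cycle (levi_graph P L I) [a, b, d]" by simp
    then show False unfolding is_cycle_3
      by (cases a; cases b; cases d) (auto simp: nbrs_levi split: if_splits)
  next
    case 2
    then obtain a b d e where "c = [a, b, d, e]" by (auto simp: numeral_eq_Suc length_Suc_conv)
    with c have "is_cycle (levi_graph P L I) [a, b, d, e]" by simp
    then show False unfolding is_cycle_4
      by (cases a; cases b; cases d; cases e)
        (auto simp: nbrs_levi split: if_splits, (metis join)+)
  next
    case 3
    then obtain a b d e f where "c = [a, b, d, e, f]"
      by (auto simp: numeral_eq_Suc length_Suc_conv)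
    with c have "is_cycle (levi_graph P L I) [a, b, d, e, f]" by simp
    then show False unfolding is_cycle_5
      by (cases a; cases b; cases d; cases e; cases f) (auto simp: nbrs_levi split: if_splits)
  qed
qed

section \<open>Triangles in projective planes\<close>

lemma card_eq_1_if_ex1:
  assumes "\<exists>!x. Q x"
  shows "card {x. Q x} = 1"
proof -
  obtain x where "Q x" "\<And>y. Q y \<Longrightarrow> y = x" using assms by metis
  then have "{x. Q x} = {x}" by blast
  then show ?thesis by simp
qed

text \<open>
  The axioms are self-dual, so that every statement about points also holds for lines.
\<close>

locale projective_plane =
  fixes P :: "'p set" and L :: "'l set" and I :: "'p \<Rightarrow> 'l \<Rightarrow> bool" and q :: nat
  assumes finite_points: "finite P"
    and finite_lines: "finite L"
    and join: "\<lbrakk>x \<in> P; y \<in> P; x \<noteq> y\<rbrakk> \<Longrightarrow> \<exists>!l. l \<in> L \<and> I x l \<and> I y l"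
    and meet: "\<lbrakk>l \<in> L; m \<in> L; l \<noteq> m\<rbrakk> \<Longrightarrow> \<exists>!x. x \<in> P \<and> I x l \<and> I x m"
    and card_range: "l \<in> L \<Longrightarrow> card {x \<in> P. I x l} = Suc q"
    and card_pencil: "x \<in> P \<Longrightarrow> card {l \<in> L. I x l} = Suc q"

text \<open>
  Projection from \<open>x\<close> is a bijection between a line that misses \<open>x\<close> and the pencil of lines
  through \<open>x\<close>.
\<close>

lemma projective_plane_if_line_sizes:
  assumes fP: "finite P" and fL: "finite L"
    and join: "\<And>x y. \<lbrakk>x \<in> P; y \<in> P; x \<noteq> y\<rbrakk> \<Longrightarrow> \<exists>!l. l \<in> L \<and> I x l \<and> I y l"
    and meet: "\<And>l m. \<lbrakk>l \<in> L; m \<in> L; l \<noteq> m\<rbrakk> \<Longrightarrow> \<exists>!x. x \<in> P \<and> I x l \<and> I x m"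
    and size: "\<And>l. l \<in> L \<Longrightarrow> card {x \<in> P. I x l} = Suc q"
    and missing: "\<And>x. x \<in> P \<Longrightarrow> \<exists>l\<in>L. \<not> I x l"
  shows "projective_plane P L I q"
proof
  fix x assume x: "x \<in> P"
  then obtain l where l: "l \<in> L" "\<not> I x l" using missing by blast
  define f where "f y = (THE m. m \<in> L \<and> I x m \<and> I y m)" for y
  have f: "f y \<in> L \<and> I x (f y) \<and> I y (f y)" if "y \<in> P" "I y l" for y
    unfolding f_def by (rule theI'[OF join]) (use x l that in auto)
  have f_eq: "f y = m" if "y \<in> P" "I y l" "m \<in> L" "I x m" "I y m" for y m
    using join[OF x that(1)] f[OF that(1,2)] that l(2) by metis
  have "bij_betw f {y \<in> P. I y l} {m \<in> L. I x m}"
  proof (rule bij_betw_imageI)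
    show "inj_on f {y \<in> P. I y l}"
      by (rule inj_onI) (metis (mono_tags, lifting) f join l mem_Collect_eq)
    show "f ` {y \<in> P. I y l} = {m \<in> L. I x m}"
    proof (intro equalityI subsetI)
      fix m assume m: "m \<in> {m \<in> L. I x m}"
      then obtain y where "y \<in> P" "I y m" "I y l" using meet[of m l] l by blast
      then show "m \<in> f ` {y \<in> P. I y l}" using f_eq m by (metis (mono_tags, lifting) image_eqI mem_Collect_eq)
    qed (use f in blast)
  qed
  then show "card {m \<in> L. I x m} = Suc q" using size[OF l(1)] by (simp add: bij_betw_same_card)
qed (use assms in auto)

context projective_plane
begin

lemma dual_plane: "projective_plane L P (\<lambda>l x. I x l) q"
proof
qed (use finite_points finite_lines join meet card_range card_pencil in auto)

lemma join_unique:
  assumes "x \<in> P" "y \<in> P" "x \<noteq> y" "l \<in> L" "I x l" "I y l" "m \<in> L" "I x m" "I y m"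
  shows "l = m"
  using join assms by blast

text \<open>
  The \<open>q + 1\<close> lines through \<open>x\<close> partition the other points into sets of size \<open>q\<close>.
\<close>

lemma card_points:
  assumes x: "x \<in> P"
  shows "card P = q\<^sup>2 + q + 1"
proof -
  have "P = insert x (\<Union>l\<in>{l \<in> L. I x l}. {y \<in> P. I y l} - {x})"
  proof (intro equalityI subsetI)
    fix y assume y: "y \<in> P"
    show "y \<in> insert x (\<Union>l\<in>{l \<in> L. I x l}. {y \<in> P. I y l} - {x})"
    proof (cases "y = x")
      case False
      then obtain l where "l \<in> L" "I x l" "I y l" using join[OF x y] by blast
      then show ?thesis using y False by blast
    qed simp
  qed (use x in blast)
  moreover have "card (insert x (\<Union>l\<in>{l \<in> L. I x l}. {y \<in> P. I y l} - {x}))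
      = Suc (card (\<Union>l\<in>{l \<in> L. I x l}. {y \<in> P. I y l} - {x}))"
    using finite_points finite_lines by (intro card_insert_disjoint) auto
  moreover have "card (\<Union>l\<in>{l \<in> L. I x l}. {y \<in> P. I y l} - {x})
      = (\<Sum>l\<in>{l \<in> L. I x l}. card ({y \<in> P. I y l} - {x}))"
  proof (rule card_UN_disjoint)
    show "\<forall>l\<in>{l \<in> L. I x l}. \<forall>m\<in>{l \<in> L. I x l}. l \<noteq> m \<longrightarrow>
        ({y \<in> P. I y l} - {x}) \<inter> ({y \<in> P. I y m} - {x}) = {}"
    proof (intro ballI impI equals0I)
      fix l m y
      assume "l \<in> {l \<in> L. I x l}" "m \<in> {l \<in> L. I x l}" "l \<noteq> m"
        and "y \<in> ({y \<in> P. I y l} - {x}) \<inter> ({y \<in> P. I y m} - {x})"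
      then show False using join_unique[OF x, of y l m] by blast
    qed
  qed (use finite_points finite_lines in auto)
  moreover have "card ({y \<in> P. I y l} - {x}) = q" if "l \<in> {l \<in> L. I x l}" for l
    using that x card_range[of l] finite_points by simp
  ultimately show ?thesis using card_pencil[OF x] by (simp add: power2_eq_square)
qed

end

text \<open>
  The side \<open>l1\<close> is opposite to the corner \<open>p1\<close>, and so on. Given by its corners and its sides in this
  way, a triangle is a self-dual notion.
\<close>

locale triangle = projective_plane P L I q
  for P :: "'p set" and L :: "'l set" and I :: "'p \<Rightarrow> 'l \<Rightarrow> bool" and q :: nat +
  fixes p1 p2 p3 :: 'p and l1 l2 l3 :: 'l
  assumes corners: "p1 \<in> P" "p2 \<in> P" "p3 \<in> P"
    and sides: "l1 \<in> L" "l2 \<in> L" "l3 \<in> L"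
    and not_opposite: "\<not> I p1 l1" "\<not> I p2 l2" "\<not> I p3 l3"
    and adjacent: "I p1 l2" "I p1 l3" "I p2 l1" "I p2 l3" "I p3 l1" "I p3 l2"
begin

abbreviation "corner_set \<equiv> {p1, p2, p3}"
abbreviation "side_set \<equiv> {l1, l2, l3}"

lemma dual_triangle: "triangle L P (\<lambda>l x. I x l) q l1 l2 l3 p1 p2 p3"
  unfolding triangle_def triangle_axioms_def
  using dual_plane corners sides not_opposite adjacent by simp

lemma distinct_corners: "p1 \<noteq> p2" "p1 \<noteq> p3" "p2 \<noteq> p3"
  using not_opposite adjacent by auto

lemma distinct_sides: "l1 \<noteq> l2" "l1 \<noteq> l3" "l2 \<noteq> l3"
  using not_opposite adjacent by auto

text \<open>
  Two sides meet in a corner only.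
\<close>

lemma side_unique:
  assumes x: "x \<in> P - corner_set" and l: "l \<in> side_set" "I x l" and m: "m \<in> side_set" "I x m"
  shows "l = m"
proof -
  have "x = p3" if "I x l1" "I x l2"
    using meet[OF sides(1,2) distinct_sides(1)] that x corners adjacent by blast
  moreover have "x = p2" if "I x l1" "I x l3"
    using meet[OF sides(1,3) distinct_sides(2)] that x corners adjacent by blast
  moreover have "x = p1" if "I x l2" "I x l3"
    using meet[OF sides(2,3) distinct_sides(3)] that x corners adjacent by blast
  ultimately show ?thesis using assms by auto
qed

lemma card_pencil_without_sides:
  assumes x: "x \<in> P - corner_set"
  shows "card {l \<in> L - side_set. I x l} = (if \<exists>l\<in>side_set. I x l then q else Suc q)"
proof (cases "\<exists>l\<in>side_set. I x l")
  case True
  then obtain l where l: "l \<in> side_set" "I x l" by blast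
  then have "{m \<in> L - side_set. I x m} = {m \<in> L. I x m} - {l}"
    using side_unique[OF x l] by blast
  moreover have "l \<in> {m \<in> L. I x m}" using l sides by auto
  ultimately show ?thesis
    using True x card_pencil[of x] finite_lines by simp
next
  case False
  then have "{m \<in> L - side_set. I x m} = {m \<in> L. I x m}" by auto
  then show ?thesis using False x card_pencil[of x] by simp
qed

lemma card_side_without_corners:
  assumes "l \<in> side_set"
  shows "card {x \<in> P - corner_set. I x l} = q - 1"
proof -
  have "\<exists>x y. x \<noteq> y \<and> x \<in> corner_set \<and> y \<in> corner_set
      \<and> {z \<in> P - corner_set. I z l} = {z \<in> P. I z l} - {x, y} \<and> I x l \<and> I y l"
    using assms not_opposite adjacent distinct_corners by auto
  then obtain x y where "x \<noteq> y" "{z \<in> P - corner_set. I z l} = {z \<in> P. I z l} - {x, y}"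
    "{x, y} \<subseteq> {z \<in> P. I z l}"
    using corners by blast
  moreover have "card {z \<in> P. I z l} = Suc q" using assms sides card_range by blast
  ultimately show ?thesis by (simp add: card_Diff_subset)
qed

lemma card_points_on_sides: "card {x \<in> P - corner_set. \<exists>l\<in>side_set. I x l} = 3 * (q - 1)"
proof -
  have "{x \<in> P - corner_set. \<exists>l\<in>side_set. I x l} = (\<Union>l\<in>side_set. {x \<in> P - corner_set. I x l})"
    by blast
  moreover have "card (\<Union>l\<in>side_set. {x \<in> P - corner_set. I x l})
      = (\<Sum>l\<in>side_set. card {x \<in> P - corner_set. I x l})"
  proof (rule card_UN_disjoint)
    show "\<forall>l\<in>side_set. \<forall>m\<in>side_set. l \<noteq> m \<longrightarrow>
        {x \<in> P - corner_set. I x l} \<inter> {x \<in> P - corner_set. I x m} = {}"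
      using side_unique by blast
  qed (use finite_points in auto)
  moreover have "\<dots> = (\<Sum>l\<in>side_set. q - 1)"
    by (rule sum.cong[OF refl card_side_without_corners])
  moreover have "\<dots> = 3 * (q - 1)" using distinct_sides by simp
  ultimately show ?thesis by metis
qed

lemma order_ge_1: "1 \<le> q"
proof -
  have "card {p2, p3} \<le> card {x \<in> P. I x l1}"
    using corners adjacent finite_points by (intro card_mono) auto
  then show ?thesis using card_range sides distinct_corners by simp
qed

lemma card_points_off_sides: "card {x \<in> P - corner_set. \<not> (\<exists>l\<in>side_set. I x l)} = (q - 1)\<^sup>2"
proof -
  let ?on = "{x \<in> P - corner_set. \<exists>l\<in>side_set. I x l}"
    and ?off = "{x \<in> P - corner_set. \<not> (\<exists>l\<in>side_set. I x l)}"
  have "card (?on \<union> ?off) = card ?on + card ?off"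
    using finite_points by (intro card_Un_disjoint) auto
  moreover have "?on \<union> ?off = P - corner_set" by blast
  moreover have "card (P - corner_set) = q\<^sup>2 + q + 1 - 3"
    using corners distinct_corners card_points by (simp add: card_Diff_subset)
  ultimately have "card ?off = q\<^sup>2 + q + 1 - 3 - 3 * (q - 1)"
    using card_points_on_sides by simp
  moreover obtain k where "q = Suc k" using order_ge_1 by (cases q) auto
  ultimately show ?thesis by (simp add: power2_eq_square)
qed

lemma join_not_side:
  assumes "x \<in> P - corner_set" "y \<in> P - corner_set" "l \<in> side_set" "m \<in> side_set" "l \<noteq> m"
    and "I x l" "I y m" "I x k" "I y k"
  shows "k \<notin> side_set"
  using side_unique assms by metis

lemma point_on_side_avoiding_line:
  assumes q: "3 \<le> q" and l: "l \<in> side_set" and m: "m \<in> L - {l}"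
  obtains x where "x \<in> P - corner_set" "I x l" "\<not> I x m"
proof -
  have lL: "l \<in> L" using l sides by auto
  have "card {x \<in> P. I x l \<and> I x m} = 1"
    using m by (intro card_eq_1_if_ex1 meet) (use lL in auto)
  moreover have "card {x \<in> P - corner_set. I x l} > 1"
    using card_side_without_corners[OF l] q by simp
  ultimately have "\<not> {x \<in> P - corner_set. I x l} \<subseteq> {x \<in> P. I x l \<and> I x m}"
    using finite_points card_mono[of "{x \<in> P. I x l \<and> I x m}" "{x \<in> P - corner_set. I x l}"] by auto
  then show ?thesis using that by blast
qed

text \<open>
  The corners of the inscribed triangle are chosen one on each side of the given triangle, the third
  one off the join of the first two. Its sides are not sides of the given triangle, since two points on
  different sides, both different from the corners, are not joined by a side.
\<close>

lemma inscribed_triangle: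
  assumes q: "3 \<le> q"
  obtains a b c k1 k2 k3
  where "{a, b, c} \<subseteq> {x \<in> P - corner_set. \<exists>l\<in>side_set. I x l}" "{k1, k2, k3} \<subseteq> L - side_set"
    "distinct [a, b, c]" "distinct [k1, k2, k3]"
    "I a k3" "I b k3" "I b k1" "I c k1" "I c k2" "I a k2"
proof -
  obtain a where a: "a \<in> P - corner_set" "I a l1"
    using point_on_side_avoiding_line[OF q, of l1 l2] sides distinct_sides by auto
  obtain b where b: "b \<in> P - corner_set" "I b l2"
    using point_on_side_avoiding_line[OF q, of l2 l1] sides distinct_sides by auto
  have ab: "a \<noteq> b" using side_unique[OF a(1), of l1 l2] a b distinct_sides by auto
  then obtain k3 where k3: "k3 \<in> L" "I a k3" "I b k3" using join a b by blast
  have k3S: "k3 \<notin> side_set" using join_not_side[OF a(1) b(1), of l1 l2] a b k3 distinct_sides by auto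
  obtain c where c: "c \<in> P - corner_set" "I c l3" "\<not> I c k3"
    using point_on_side_avoiding_line[OF q, of l3 k3] k3 k3S by auto
  have ne: "a \<noteq> c" "b \<noteq> c" using c k3 by auto
  obtain k1 where k1: "k1 \<in> L" "I b k1" "I c k1" using join b c ne by blast
  obtain k2 where k2: "k2 \<in> L" "I a k2" "I c k2" using join a c ne by blast
  have "k1 \<notin> side_set" using join_not_side[OF b(1) c(1), of l2 l3] b c k1 distinct_sides by auto
  moreover have "k2 \<notin> side_set"
    using join_not_side[OF a(1) c(1), of l1 l3] a c k2 distinct_sides by auto
  moreover have "k1 \<noteq> k3" "k2 \<noteq> k3" using c k1 k2 by auto
  moreover have "k1 \<noteq> k2" using join_unique[of a b k1 k3] a b ab k1 k2 k3 \<open>k1 \<noteq> k3\<close> by auto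
  ultimately show ?thesis
    using that[of a b c k1 k2 k3] a b c ab ne k1 k2 k3 k3S by auto
qed

text \<open>
  At most three of the \<open>q + 1\<close> lines through \<open>x\<close> contain a corner.
\<close>

lemma card_lines_avoiding_corners:
  assumes x: "x \<in> P - corner_set"
  shows "q - 2 \<le> card {l \<in> L. I x l \<and> \<not> (\<exists>p\<in>corner_set. I p l)}"
proof -
  let ?good = "{l \<in> L. I x l \<and> \<not> (\<exists>p\<in>corner_set. I p l)}"
    and ?bad = "\<Union>p\<in>corner_set. {l \<in> L. I x l \<and> I p l}"
  have "card {l \<in> L. I x l \<and> I p l} = 1" if "p \<in> corner_set" for p
    by (intro card_eq_1_if_ex1 join) (use x that corners in auto)
  then have "(\<Sum>p\<in>corner_set. card {l \<in> L. I x l \<and> I p l}) \<le> 3"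
    using distinct_corners by simp
  then have "card ?bad \<le> 3" using card_UN_le[of corner_set "\<lambda>p. {l \<in> L. I x l \<and> I p l}"] by auto
  moreover have "{l \<in> L. I x l} = ?good \<union> ?bad" by blast
  then have "Suc q \<le> card ?good + card ?bad"
    using card_pencil[of x] x card_Un_le[of ?good ?bad] by simp
  ultimately show ?thesis by linarith
qed

text \<open>
  For \<open>4 \<le> q\<close> there are two lines through the second point that miss the corners, so one of them
  differs from the line chosen through the first point.
\<close>

lemma two_flags_off_triangle:
  assumes q: "4 \<le> q"
  obtains x y l m
  where "{x, y} \<subseteq> {x \<in> P - corner_set. \<not> (\<exists>l\<in>side_set. I x l)}"
    "{l, m} \<subseteq> {l \<in> L - side_set. \<not> (\<exists>p\<in>corner_set. I p l)}"
    "x \<noteq> y" "l \<noteq> m" "I x l" "I y m"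
proof -
  have two: "\<exists>z\<in>A. z \<noteq> w" if "2 \<le> card A" for A and w :: 'z
    using that card_mono[of "{w}" A] by (cases "A \<subseteq> {w}") auto
  have "2 \<le> (q - 1)\<^sup>2" using power_mono[of 3 "q - 1" 2] q by simp
  then have "2 \<le> card {x \<in> P - corner_set. \<not> (\<exists>l\<in>side_set. I x l)}"
    by (simp only: card_points_off_sides)
  then obtain x y where xy: "{x, y} \<subseteq> {x \<in> P - corner_set. \<not> (\<exists>l\<in>side_set. I x l)}" "x \<noteq> y"
    using two by (metis (no_types, lifting) empty_subsetI insert_subset)
  have lines: "2 \<le> card {l \<in> L. I z l \<and> \<not> (\<exists>p\<in>corner_set. I p l)}" if "z \<in> {x, y}" for z
    using card_lines_avoiding_corners[of z] that xy q by fastforce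
  obtain l where l: "l \<in> L" "I x l" "\<not> (\<exists>p\<in>corner_set. I p l)"
    using two[OF lines[of x]] by blast
  obtain m where m: "m \<in> L" "I y m" "\<not> (\<exists>p\<in>corner_set. I p m)" "l \<noteq> m"
    using two[OF lines[of y], of l] by blast
  have "l \<notin> side_set" "m \<notin> side_set" using l m adjacent by auto
  then show ?thesis using that[of x y l m] xy l m by auto
qed

end

section \<open>The Levi graph of a plane without a triangle\<close>

context triangle
begin

abbreviation "deleted_levi \<equiv> levi_graph (P - corner_set) (L - side_set) I"

lemma finite_without_triangle: "finite (P - corner_set)" "finite (L - side_set)"
  using finite_points finite_lines by auto

lemma vdegree_point:
  assumes "x \<in> P - corner_set"
  shows "vdegree deleted_levi (Inl x) = (if \<exists>l\<in>side_set. I x l then q else Suc q)"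
  unfolding vdegree_levi(1)[OF finite_without_triangle assms]
  by (rule card_pencil_without_sides[OF assms])

lemma vdegree_line:
  assumes "l \<in> L - side_set"
  shows "vdegree deleted_levi (Inr l) = (if \<exists>p\<in>corner_set. I p l then q else Suc q)"
  unfolding vdegree_levi(2)[OF finite_without_triangle assms]
  by (rule triangle.card_pencil_without_sides[OF dual_triangle assms])

lemma vdegree_point_iff:
  assumes "x \<in> P - corner_set"
  shows "vdegree deleted_levi (Inl x) = q \<longleftrightarrow> (\<exists>l\<in>side_set. I x l)"
    and "vdegree deleted_levi (Inl x) = Suc q \<longleftrightarrow> \<not> (\<exists>l\<in>side_set. I x l)"
  unfolding vdegree_point[OF assms] by (simp_all only: split: if_split) simp_all

lemma vdegree_line_iff:
  assumes "l \<in> L - side_set"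
  shows "vdegree deleted_levi (Inr l) = q \<longleftrightarrow> (\<exists>p\<in>corner_set. I p l)"
    and "vdegree deleted_levi (Inr l) = Suc q \<longleftrightarrow> \<not> (\<exists>p\<in>corner_set. I p l)"
  unfolding vdegree_line[OF assms] by (simp_all only: split: if_split) simp_all

lemma card_low_degree: "card {v \<in> verts deleted_levi. vdegree deleted_levi v = q} = 6 * (q - 1)"
proof -
  have "{x \<in> P - corner_set. vdegree deleted_levi (Inl x) = q}
      = {x \<in> P - corner_set. \<exists>l\<in>side_set. I x l}"
    by (intro Collect_cong conj_cong refl) (rule vdegree_point_iff)
  moreover have "{l \<in> L - side_set. vdegree deleted_levi (Inr l) = q}
      = {l \<in> L - side_set. \<exists>p\<in>corner_set. I p l}"
    by (intro Collect_cong conj_cong refl) (rule vdegree_line_iff)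
  ultimately show ?thesis
    by (simp only: card_verts_levi[OF finite_without_triangle]
        card_points_on_sides triangle.card_points_on_sides[OF dual_triangle])
qed

lemma card_high_degree:
  "card {v \<in> verts deleted_levi. vdegree deleted_levi v = Suc q} = 2 * (q - 1)\<^sup>2"
proof -
  have "{x \<in> P - corner_set. vdegree deleted_levi (Inl x) = Suc q}
      = {x \<in> P - corner_set. \<not> (\<exists>l\<in>side_set. I x l)}"
    by (intro Collect_cong conj_cong refl) (rule vdegree_point_iff)
  moreover have "{l \<in> L - side_set. vdegree deleted_levi (Inr l) = Suc q}
      = {l \<in> L - side_set. \<not> (\<exists>p\<in>corner_set. I p l)}"
    by (intro Collect_cong conj_cong refl) (rule vdegree_line_iff)
  ultimately show ?thesis
    by (simp only: card_verts_levi[OF finite_without_triangle]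
        card_points_off_sides triangle.card_points_off_sides[OF dual_triangle] mult_2)
qed

lemma vdegree_cases:
  "\<forall>v\<in>verts deleted_levi. vdegree deleted_levi v = q \<or> vdegree deleted_levi v = Suc q"
proof
  fix v assume "v \<in> verts deleted_levi"
  then consider x where "v = Inl x" "x \<in> P - corner_set" | l where "v = Inr l" "l \<in> L - side_set"
    by (auto simp: levi_graph_def)
  then show "vdegree deleted_levi v = q \<or> vdegree deleted_levi v = Suc q"
    by cases (simp_all only: vdegree_point vdegree_line split: if_split, simp_all)
qed

lemma order_deleted_levi: "graph_order deleted_levi = 2 * (q - 1) * (q + 2)"
proof -
  have "card (verts deleted_levi)
      = card {v \<in> verts deleted_levi. vdegree deleted_levi v = q}
        + card {v \<in> verts deleted_levi. vdegree deleted_levi v = Suc q}"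
    using finite_without_triangle vdegree_cases
    by (subst card_Un_disjoint[symmetric]) (auto simp: levi_graph_def intro!: arg_cong[where f = card])
  moreover obtain k where "q = Suc k" using order_ge_1 by (cases q) auto
  ultimately show ?thesis
    unfolding graph_order_def card_low_degree card_high_degree
    by (simp add: power2_eq_square algebra_simps)
qed

text \<open>
  The corners and sides of an inscribed triangle form a cycle of length six. Its points are on sides of
  the given triangle, hence of degree \<open>q\<close>, so that no edge of \<open>M\<close> meets them.
\<close>

lemma girth_delete_edges:
  assumes q: "3 \<le> q"
    and Mdeg: "\<forall>e\<in>M. \<forall>v\<in>e. vdegree deleted_levi v = Suc q"
  shows "girth (delete_edges deleted_levi M) = 6"
proof (rule antisym)
  let ?G = deleted_levi
  obtain a b c k1 k2 k3
    where pts: "{a, b, c} \<subseteq> {x \<in> P - corner_set. \<exists>l\<in>side_set. I x l}"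
      and lns: "{k1, k2, k3} \<subseteq> L - side_set"
      and dist: "distinct [a, b, c]" "distinct [k1, k2, k3]"
      and inc: "I a k3" "I b k3" "I b k1" "I c k1" "I c k2" "I a k2"
    by (rule inscribed_triangle[OF q])
  have notM: "e \<notin> M" if "Inl x \<in> e" "x \<in> {a, b, c}" for x e
  proof -
    have "vdegree ?G (Inl x) = q" using vdegree_point[of x] that(2) pts by auto
    then show ?thesis using Mdeg that(1) by fastforce
  qed
  have "is_cycle (delete_edges ?G M) [Inl a, Inr k3, Inl b, Inr k1, Inl c, Inr k2]"
    unfolding is_cycle_6 nbrs_def delete_edges_def
    using pts lns dist inc notM[of a] notM[of b] notM[of c]
    by (auto simp: levi_graph_def insert_commute)
  then have "girth (delete_edges ?G M) \<le> enat (length [Inl a, Inr k3, Inl b, Inr k1, Inl c, Inr k2])"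
    unfolding girth_def by (intro INF_lower) simp
  then show "girth (delete_edges ?G M) \<le> 6" by (simp add: numeral_eq_enat eval_nat_numeral)
  have "6 \<le> length cyc" if "is_cycle ?G cyc" for cyc
    by (rule levi_cycle_length[OF _ that]) (metis DiffD1 join_unique)
  then have "enat 6 \<le> girth (delete_edges ?G M)"
    by (simp only: girth_ge_iff is_cycle_delete_edges) blast
  then show "6 \<le> girth (delete_edges ?G M)" by (simp add: numeral_eq_enat)
qed

text \<open>
  The equation between \<open>q\<close> and \<open>card M\<close> says that the deletion of \<open>M\<close> equalizes the two classes.
\<close>

lemma babi_graph_delete_edges:
  assumes q: "3 \<le> q" and M: "M \<subseteq> edges deleted_levi" "independent_edges M"
    and Mdeg: "\<forall>e\<in>M. \<forall>v\<in>e. vdegree deleted_levi v = Suc q"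
    and size: "6 * (q - 1) + 4 * card M = 2 * (q - 1)\<^sup>2"
  shows "babi_graph q (Suc q) 6 (delete_edges deleted_levi M)"
proof -
  have sg: "simple_graph deleted_levi" using simple_graph_levi finite_without_triangle .
  have "0 < card {v \<in> verts deleted_levi. vdegree deleted_levi v = q}"
    using q card_low_degree by simp
  note balanced = balanced_delete_independent_edges[OF sg M Mdeg vdegree_cases this
      size[folded card_low_degree card_high_degree]]
  show ?thesis
    unfolding babi_graph_def
    using balanced girth_delete_edges[OF q Mdeg] simple_graph_delete_edges[OF sg]
    by (simp add: numeral_eq_enat)
qed

lemma two_independent_edges:
  assumes q: "4 \<le> q"
  obtains M where "M \<subseteq> edges deleted_levi" "independent_edges M" "card M = 2"
    "\<forall>e\<in>M. \<forall>v\<in>e. vdegree deleted_levi v = Suc q"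
proof -
  obtain x y l m
    where pts: "{x, y} \<subseteq> {x \<in> P - corner_set. \<not> (\<exists>l\<in>side_set. I x l)}"
      and lns: "{l, m} \<subseteq> {l \<in> L - side_set. \<not> (\<exists>p\<in>corner_set. I p l)}"
      and ne: "x \<noteq> y" "l \<noteq> m" and inc: "I x l" "I y m"
    by (rule two_flags_off_triangle[OF q])
  let ?M = "{{Inl x, Inr l}, {Inl y, Inr m}}"
  show ?thesis
  proof (rule that[of ?M])
    show "?M \<subseteq> edges deleted_levi" using pts lns inc by (auto simp: levi_graph_def)
    show "independent_edges ?M"
      using ne by (auto simp: independent_edges_def pairwise_insert disjnt_iff)
    show "card ?M = 2" using ne by (simp add: doubleton_eq_iff)
    show "\<forall>e\<in>?M. \<forall>v\<in>e. vdegree deleted_levi v = Suc q"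
      using pts lns vdegree_point vdegree_line by auto
  qed
qed

end

section \<open>The projective plane over a finite field\<close>

text \<open>
  Each new basis vector multiplies the size by the size of the field: the vectors of the larger span
  are uniquely \<open>c *s b + x\<close> with \<open>x\<close> in the smaller one.
\<close>

lemma card_span_independent:
  fixes B :: "('k::{field,finite} ^ 'n) set"
  assumes "finite B" "vec.independent B"
  shows "card (vec.span B) = CARD('k) ^ card B"
  using assms
proof (induction B)
  case (insert b B)
  have b: "b \<notin> vec.span B" and ind: "vec.independent B"
    using insert.prems insert.hyps(2) by (simp_all add: vec.independent_insert)
  let ?f = "\<lambda>(c, x). c *s b + x"
  have "inj_on ?f (UNIV \<times> vec.span B)"
  proof (rule inj_onI, clarsimp)
    fix c d x y assume A: "x \<in> vec.span B" "y \<in> vec.span B" "c *s b + x = d *s b + y"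
    then have "(c - d) *s b = y - x" by (simp add: vec.scale_left_diff_distrib algebra_simps)
    then have "(c - d) *s b \<in> vec.span B" using A vec.span_diff by simp
    then have "c = d"
      using b vec.span_scale[of "(c - d) *s b" B "inverse (c - d)"] by (cases "c = d") auto
    then show "c = d \<and> x = y" using A by simp
  qed
  moreover have "?f ` (UNIV \<times> vec.span B) = vec.span (insert b B)"
  proof (intro equalityI subsetI)
    fix z assume "z \<in> vec.span (insert b B)"
    then obtain c where "z - c *s b \<in> vec.span B" by (auto simp: vec.span_breakdown_eq)
    then show "z \<in> ?f ` (UNIV \<times> vec.span B)"
      by (intro image_eqI[of _ _ "(c, z - c *s b)"]) auto
  next
    fix z assume "z \<in> ?f ` (UNIV \<times> vec.span B)"
    then obtain c x where "z = c *s b + x" "x \<in> vec.span B" by auto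
    then show "z \<in> vec.span (insert b B)"
      using vec.span_mono[of B "insert b B"]
      by (auto intro: vec.span_add vec.span_scale vec.span_base)
  qed
  ultimately have "card (vec.span (insert b B)) = card ((UNIV :: 'k set) \<times> vec.span B)"
    by (metis card_image)
  then show ?case using insert ind by (simp add: card_cartesian_product)
qed (simp add: vec.span_empty)

lemma card_subspace:
  fixes S :: "('k::{field,finite} ^ 'n) set"
  assumes "vec.subspace S"
  shows "card S = CARD('k) ^ vec.dim S"
proof -
  obtain B where B: "B \<subseteq> S" "vec.independent B" "S \<subseteq> vec.span B" "card B = vec.dim S"
    using vec.basis_exists by metis
  then have "vec.span B = S" using assms vec.span_subspace by metis
  then show ?thesis using card_span_independent[of B] B by simp
qed

lemma pg_point_dim_cases:
  assumes "p \<in> pg_points" "vec.subspace S" "S \<subseteq> p"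
  shows "vec.dim S = 0 \<or> S = p"
  using assms vec.subspace_dim_equal[of S p] by (cases "vec.dim S = 0") (auto simp: pg_points_def)

text \<open>
  Distinct points intersect in \<open>{0}\<close>, so their sum has dimension two.
\<close>

lemma pg_join:
  assumes p: "p \<in> pg_points" and p': "p' \<in> pg_points" and ne: "p \<noteq> p'"
  shows "\<exists>!l. l \<in> pg_lines \<and> p \<subseteq> l \<and> p' \<subseteq> l"
proof -
  have sub: "vec.subspace p" "vec.subspace p'" "vec.dim p = 1" "vec.dim p' = 1"
    using p p' by (auto simp: pg_points_def)
  define S where "S = {x + y |x y. x \<in> p \<and> y \<in> p'}"
  have "vec.dim (p \<inter> p') = 0"
    using pg_point_dim_cases[OF p, of "p \<inter> p'"] pg_point_dim_cases[OF p', of "p \<inter> p'"] sub ne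
      vec.subspace_inter by blast
  then have dimS: "vec.dim S = 2" using vec.dim_sums_Int[OF sub(1,2), folded S_def] sub(3,4) by linarith
  have subS: "vec.subspace S" using vec.subspace_sums[OF sub(1,2)] by (simp add: S_def)
  have "p \<subseteq> S" "p' \<subseteq> S"
    unfolding S_def using vec.subspace_0[OF sub(1)] vec.subspace_0[OF sub(2)] by force+
  moreover have "l = S" if "l \<in> pg_lines" "p \<subseteq> l" "p' \<subseteq> l" for l
  proof -
    have l: "vec.subspace l" "vec.dim l = 2" using that by (auto simp: pg_lines_def)
    then have "S \<subseteq> l" unfolding S_def using that vec.subspace_add[OF l(1)] by blast
    then show ?thesis using vec.subspace_dim_equal[OF subS l(1)] l dimS by simp
  qed
  moreover have "S \<in> pg_lines" using subS dimS unfolding pg_lines_def by blast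
  ultimately show ?thesis by metis
qed

text \<open>
  The sum of two distinct lines has dimension three, which leaves dimension one for their intersection.
\<close>

lemma pg_meet:
  assumes l: "l \<in> pg_lines" and m: "m \<in> pg_lines" and ne: "l \<noteq> m"
  shows "\<exists>!p. p \<in> pg_points \<and> p \<subseteq> l \<and> p \<subseteq> m"
proof -
  have sub: "vec.subspace l" "vec.subspace m" "vec.dim l = 2" "vec.dim m = 2"
    using l m by (auto simp: pg_lines_def)
  have subI: "vec.subspace (l \<inter> m)" using sub vec.subspace_inter by blast
  have "vec.dim {x + y |x y. x \<in> l \<and> y \<in> m} \<le> 3"
    using dim_subset_UNIV_cart_gen[of "{x + y |x y. x \<in> l \<and> y \<in> m}"] by simp
  then have "1 \<le> vec.dim (l \<inter> m)" using vec.dim_sums_Int[OF sub(1,2)] sub by simp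
  moreover have "\<not> 2 \<le> vec.dim (l \<inter> m)"
    using vec.subspace_dim_equal[OF subI sub(1)] vec.subspace_dim_equal[OF subI sub(2)] sub ne by auto
  ultimately have dimI: "vec.dim (l \<inter> m) = 1" by simp
  then have "l \<inter> m \<in> pg_points" using subI by (simp add: pg_points_def)
  moreover have "p = l \<inter> m" if "p \<in> pg_points" "p \<subseteq> l" "p \<subseteq> m" for p
    using vec.subspace_dim_equal[OF _ subI, of p] that dimI by (simp add: pg_points_def)
  ultimately show ?thesis by (metis Int_lower1 Int_lower2)
qed

text \<open>
  The \<open>q\<^sup>2 - 1\<close> nonzero vectors of a line are partitioned by its points, with \<open>q - 1\<close> vectors each.
\<close>

lemma card_pg_points_on_line:
  fixes l :: "('k::{field,finite} ^ 3) set"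
  assumes l: "l \<in> pg_lines"
  shows "card {p \<in> pg_points. p \<subseteq> l} = Suc CARD('k)"
proof -
  let ?q = "CARD('k)" and ?A = "{p \<in> pg_points. p \<subseteq> l}"
  have subl: "vec.subspace l" "vec.dim l = 2" using l by (auto simp: pg_lines_def)
  have "l - {0} = (\<Union>p\<in>?A. p - {0})"
  proof (intro equalityI subsetI)
    fix x assume x: "x \<in> l - {0}"
    then have "vec.span {x} \<in> pg_points" by (simp add: pg_points_def)
    moreover have "vec.span {x} \<subseteq> l" using x subl vec.span_minimal[of "{x}" l] by simp
    moreover have "x \<in> vec.span {x}" by (simp add: vec.span_base)
    ultimately show "x \<in> (\<Union>p\<in>?A. p - {0})" using x by blast
  qed blast
  moreover have "card (\<Union>p\<in>?A. p - {0}) = (\<Sum>p\<in>?A. card (p - {0}))"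
  proof (rule card_UN_disjoint)
    show "\<forall>p\<in>?A. \<forall>p'\<in>?A. p \<noteq> p' \<longrightarrow> (p - {0}) \<inter> (p' - {0}) = {}"
    proof (intro ballI impI)
      fix p p' assume A: "p \<in> ?A" "p' \<in> ?A" "p \<noteq> p'"
      then have "vec.dim (p \<inter> p') = 0"
        using pg_point_dim_cases[of p "p \<inter> p'"] pg_point_dim_cases[of p' "p \<inter> p'"]
          vec.subspace_inter[of p p'] by (auto simp: pg_points_def)
      then show "(p - {0}) \<inter> (p' - {0}) = {}" by auto
    qed
  qed auto
  moreover have "card (p - {0}) = ?q - 1" if "p \<in> ?A" for p
    using that vec.subspace_0[of p] card_subspace[of p] by (simp add: pg_points_def)
  moreover have "card (l - {0}) = ?q\<^sup>2 - 1"
    using vec.subspace_0[OF subl(1)] card_subspace[OF subl(1)] subl by simp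
  ultimately have "card ?A * (?q - 1) = ?q\<^sup>2 - 1" by simp
  also have "\<dots> = Suc ?q * (?q - 1)" by (simp add: power2_eq_square algebra_simps)
  finally have "card ?A * (?q - 1) = Suc ?q * (?q - 1)" .
  moreover have "card {0, 1 :: 'k} \<le> ?q" by (rule card_mono) auto
  then have "?q - 1 \<noteq> 0" by simp
  ultimately show ?thesis using mult_right_cancel by blast
qed

text \<open>
  The span of the last two vectors of a basis whose first vector spans \<open>p\<close>.
\<close>

lemma pg_line_missing_point:
  fixes p :: "('k::field ^ 3) set"
  assumes p: "p \<in> pg_points"
  shows "\<exists>l\<in>pg_lines. \<not> p \<subseteq> l"
proof -
  have big: "\<exists>z. z \<notin> vec.span S" if "vec.dim S < 3" for S :: "('k ^ 3) set"
  proof (rule ccontr)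
    assume "\<nexists>z. z \<notin> vec.span S"
    then have "vec.span S = UNIV" by blast
    then have "vec.dim S = CARD(3)"
      using vec.dim_span[of S] vec_dim_card[where 'n = 3 and 'a = 'k] by metis
    then show False using that by simp
  qed
  have subp: "vec.subspace p" "vec.dim p = 1" using p by (auto simp: pg_points_def)
  obtain y where y: "y \<notin> vec.span p" using big[of p] subp by auto
  obtain z where z: "z \<notin> vec.span (insert y p)" using big[of "insert y p"] y subp by (auto simp: vec.dim_insert)
  let ?l = "vec.span {z, y}"
  have "z \<notin> vec.span {y}" using z vec.span_mono[of "{y}" "insert y p"] by blast
  moreover have "y \<noteq> 0" using y vec.span_zero[of p] by blast
  ultimately have dim_l: "vec.dim ?l = 2" by (simp add: vec.dim_insert)
  have "vec.dim (insert z (insert y p)) = 3" using y z subp by (simp add: vec.dim_insert)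
  moreover have "vec.dim (insert z (insert y p)) \<le> vec.dim ?l" if "p \<subseteq> ?l"
    using that by (intro vec.dim_subset) (auto intro: vec.span_base)
  ultimately have "\<not> p \<subseteq> ?l" using dim_l by auto
  then show ?thesis using dim_l by (intro bexI[of _ ?l]) (auto simp: pg_lines_def)
qed

lemma projective_plane_PG:
  "projective_plane (pg_points :: ('k::{field,finite} ^ 3) set set) pg_lines (\<subseteq>) CARD('k)"
  by (rule projective_plane_if_line_sizes)
    ((rule finite pg_join pg_meet card_pg_points_on_line pg_line_missing_point; assumption)+)

lemma line_through:
  assumes "p \<in> pg_points" "p' \<in> pg_points" "p \<noteq> p'"
  shows "line_through p p' \<in> pg_lines" "p \<subseteq> line_through p p'" "p' \<subseteq> line_through p p'"
  using theI'[OF pg_join[OF assms]] by (auto simp: line_through_def)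

text \<open>
  Any two points, equal or not, are on a common line. So three points that are not collinear are distinct,
  and none of them is on the line through the other two.
\<close>

lemma triangle_PG:
  fixes P1 P2 P3 :: "('k::{field,finite} ^ 3) set"
  assumes P: "P1 \<in> pg_points" "P2 \<in> pg_points" "P3 \<in> pg_points"
    and nc: "\<not> collinear_points {P1, P2, P3}"
  shows "triangle pg_points pg_lines (\<subseteq>) CARD('k) P1 P2 P3
    (line_through P2 P3) (line_through P3 P1) (line_through P1 P2)"
proof -
  have not_all: "\<not> (P1 \<subseteq> l \<and> P2 \<subseteq> l \<and> P3 \<subseteq> l)" if "l \<in> pg_lines" for l
    using nc that by (auto simp: collinear_points_def)
  have line: "\<exists>l\<in>pg_lines. p \<subseteq> l \<and> p' \<subseteq> l" if "p \<in> pg_points" "p' \<in> pg_points"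
    for p p' :: "('k ^ 3) set"
  proof (cases "p = p'")
    case True
    have "card {l \<in> pg_lines. p \<subseteq> l} = Suc CARD('k)"
      by (rule projective_plane.card_pencil[OF projective_plane_PG that(1)])
    then have "{l \<in> pg_lines. p \<subseteq> l} \<noteq> {}" by force
    then show ?thesis using True by auto
  next
    case False
    then show ?thesis using pg_join[OF that] by blast
  qed
  have "P1 \<noteq> P2" "P2 \<noteq> P3" "P3 \<noteq> P1"
    using line[OF P(1) P(3)] line[OF P(1) P(2)] not_all by blast+
  note lines = line_through[OF P(2,3) \<open>P2 \<noteq> P3\<close>] line_through[OF P(3,1) \<open>P3 \<noteq> P1\<close>]
    line_through[OF P(1,2) \<open>P1 \<noteq> P2\<close>]
  show ?thesis
    unfolding triangle_def triangle_axioms_def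
    using projective_plane_PG P lines not_all[OF lines(1)] not_all[OF lines(4)] not_all[OF lines(7)]
    by simp
qed

section \<open>Two cages\<close>

lemma triangle_deleted_eq_levi:
  "triangle_deleted P1 P2 P3 = levi_graph (pg_points - {P1, P2, P3})
     (pg_lines - {line_through P2 P3, line_through P3 P1, line_through P1 P2}) (\<subseteq>)"
proof -
  have "{Inl P1, Inl P2, Inl P3,
      Inr (line_through P1 P2), Inr (line_through P2 P3), Inr (line_through P3 P1)}
    = Inl ` {P1, P2, P3} \<union> Inr ` {line_through P2 P3, line_through P3 P1, line_through P1 P2}"
    by auto
  then show ?thesis by (simp only: triangle_deleted_def pg_levi_graph_def delete_verts_levi)
qed

lemma graph_order_delete_edges: "graph_order (delete_edges G M) = graph_order G"
  by (simp add: graph_order_def delete_edges_def)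

theorem corollary6p6:
  fixes r :: nat and P1 P2 P3 :: "('k::{field,finite} ^ 3) set"
  assumes "r \<in> {4, 5}"
    and "CARD('k) = r"
    and "P1 \<in> pg_points" and "P2 \<in> pg_points" and "P3 \<in> pg_points"
    and "\<not> collinear_points {P1, P2, P3}"
  shows "\<exists>M \<subseteq> edges (triangle_deleted P1 P2 P3).
      independent_edges M \<and>
      (\<forall>e\<in>M. \<forall>v\<in>e. vdegree (triangle_deleted P1 P2 P3) v = r + 1) \<and>
      (r = 4 \<longrightarrow>
        babi_cage 4 5 6 (delete_edges (triangle_deleted P1 P2 P3) M) \<and>
        graph_order (delete_edges (triangle_deleted P1 P2 P3) M) = 36) \<and>
      (r = 5 \<longrightarrow>
        babi_cage 5 6 6 (delete_edges (triangle_deleted P1 P2 P3) M) \<and>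
        graph_order (delete_edges (triangle_deleted P1 P2 P3) M) = 56)"
proof -
  let ?G = "triangle_deleted P1 P2 P3"
  interpret triangle pg_points pg_lines "(\<subseteq>)" r P1 P2 P3
    "line_through P2 P3" "line_through P3 P1" "line_through P1 P2"
    using triangle_PG[OF assms(3-6)] assms(2) by simp
  have G: "deleted_levi = ?G" by (simp only: triangle_deleted_eq_levi)
  have r: "r = 4 \<or> r = 5" using assms(1) by simp
  have order: "graph_order (delete_edges ?G M) = 2 * (r - 1) * (r + 2)" for M
    using order_deleted_levi by (simp only: G graph_order_delete_edges)
  have lower: "2 * (r - 1) * (r + 2) \<le> graph_order H"
    if "babi_graph r (Suc r) 6 H" for H :: "nat sgraph"
  proof -
    have "4 dvd graph_order H" "2 * r\<^sup>2 + 3 \<le> graph_order H"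
      using babi_graph_order_lower_bound[OF that] r by auto
    then obtain k where "graph_order H = 4 * k" "2 * r\<^sup>2 + 3 \<le> 4 * k" by (metis dvdE)
    then show ?thesis using r by (auto simp: power2_eq_square)
  qed
  obtain M where M: "M \<subseteq> edges ?G" "independent_edges M"
    "\<forall>e\<in>M. \<forall>v\<in>e. vdegree ?G v = Suc r" "card M = (if r = 4 then 0 else 2)"
  proof (cases "r = 4")
    case True
    show ?thesis by (rule that[of "{}"]) (simp_all add: True independent_edges_def)
  next
    case False
    then have "4 \<le> r" using r by simp
    then obtain N where N: "N \<subseteq> edges ?G" "independent_edges N" "card N = 2"
      "\<forall>e\<in>N. \<forall>v\<in>e. vdegree ?G v = Suc r"
      by (rule two_independent_edges[unfolded G])
    show ?thesis by (rule that[OF N(1,2,4)]) (simp add: False N(3))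
  qed
  have size: "3 \<le> r" "6 * (r - 1) + 4 * card M = 2 * (r - 1)\<^sup>2"
    using r M(4) by (auto simp: power2_eq_square)
  have "babi_graph r (Suc r) 6 (delete_edges ?G M)"
    by (rule babi_graph_delete_edges[unfolded G, OF size(1) M(1-3) size(2)])
  then have cage: "babi_cage r (Suc r) 6 (delete_edges ?G M)"
    unfolding babi_cage_def order using lower by blast
  have "r = 4 \<longrightarrow> babi_cage 4 5 6 (delete_edges ?G M) \<and> graph_order (delete_edges ?G M) = 36"
    "r = 5 \<longrightarrow> babi_cage 5 6 6 (delete_edges ?G M) \<and> graph_order (delete_edges ?G M) = 56"
    using cage order[of M] by (auto simp: eval_nat_numeral)
  then show ?thesis using M(1-3) by (metis Suc_eq_plus1)
qed

end
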